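(* For every integer $k\ge0$ there is a graph $G_k$ with tree-width at most $k$ and track-number $\mathrm{tn}(G_k)=\tfrac12(k+1)(k+2)$.
   Context: A colouring of $G$ is a partition $\{V_i:i\in I\}$ of $V(G)$ with no edge inside a class; a track assignment is a colouring with a total order $<_i$ on each $V_i$; an X-crossing is a pair of edges $vw$, $xy$ with $v,x\in V_i$, $w,y\in V_j$, $i\ne j$, $v<_i x$, $y<_j w$; a $t$-track layout is a track assignment with $t$ tracks and no X-crossing; the track-number $\mathrm{tn}(G)$ is the minimum such $t$. *)

theory Defs
  imports
    Complex_Main
    "HOL-Library.Disjoint_Sets"
    "Graph_Theory.Digraph_Component"
    "Graph_Theory.Pair_Digraph"
begin

text \<open>
  A finite simple undirected graph is a \<^locale>\<open>pair_graph\<close>: a finite vertex set together with a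
  symmetric irreflexive relation \<^const>\<open>parcs\<close>, in which an edge \<open>vw\<close> is present as both
  \<open>(v, w)\<close> and \<open>(w, v)\<close>.
\<close>

section \<open>Track layouts\<close>

text \<open>
  A track assignment is given by the set \<open>P\<close> of colour classes and an order \<open>r V\<close> for each
  \<open>V \<in> P\<close>. The classes serve as their own indices, so the number of tracks is \<open>card P\<close>.
\<close>

definition is_colouring :: "'a pair_pre_digraph \<Rightarrow> 'a set set \<Rightarrow> bool" where
  "is_colouring G P \<longleftrightarrow>
     partition_on (pverts G) P \<and>
     (\<forall>V\<in>P. \<forall>v\<in>V. \<forall>w\<in>V. (v, w) \<notin> parcs G)"

definition track_assignment ::
    "'a pair_pre_digraph \<Rightarrow> 'a set set \<Rightarrow> ('a set \<Rightarrow> 'a rel) \<Rightarrow> bool" where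
  "track_assignment G P r \<longleftrightarrow>
     is_colouring G P \<and>
     (\<forall>V\<in>P. r V \<subseteq> V \<times> V \<and> strict_linear_order_on V (r V))"

definition has_X_crossing ::
    "'a pair_pre_digraph \<Rightarrow> 'a set set \<Rightarrow> ('a set \<Rightarrow> 'a rel) \<Rightarrow> bool" where
  "has_X_crossing G P r \<longleftrightarrow>
     (\<exists>V\<in>P. \<exists>W\<in>P. V \<noteq> W \<and>
       (\<exists>v\<in>V. \<exists>x\<in>V. \<exists>w\<in>W. \<exists>y\<in>W.
          (v, w) \<in> parcs G \<and> (x, y) \<in> parcs G \<and> (v, x) \<in> r V \<and> (y, w) \<in> r W))"

definition track_layout ::
    "'a pair_pre_digraph \<Rightarrow> nat \<Rightarrow> 'a set set \<Rightarrow> ('a set \<Rightarrow> 'a rel) \<Rightarrow> bool" where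
  "track_layout G t P r \<longleftrightarrow>
     track_assignment G P r \<and> finite P \<and> card P = t \<and> \<not> has_X_crossing G P r"

definition track_number :: "'a pair_pre_digraph \<Rightarrow> nat" where
  "track_number G = (LEAST t. \<exists>P r. track_layout G t P r)"

section \<open>Tree-width\<close>

text \<open>
  The constant \<^const>\<open>tree\<close> of the Graph_Theory library is unsuitable here: it also forbids the closed
  walk \<open>a, b, a\<close>, hence no symmetric digraph with an edge is a \<^const>\<open>tree\<close>. In a loop-free
  symmetric digraph the cycles with at least three arcs are exactly the cycles of the
  undirected graph. Note that \<^const>\<open>connected\<close> includes non-emptiness.
\<close>

definition undirected_tree :: "'b pair_pre_digraph \<Rightarrow> bool" where
  "undirected_tree T \<longleftrightarrow>
     pair_graph T \<and> connected (with_proj T) \<and>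
     \<not> (\<exists>p. pre_digraph.cycle (with_proj T) p \<and> length p \<ge> 3)"

definition tree_decomposition ::
    "'a pair_pre_digraph \<Rightarrow> 'b pair_pre_digraph \<Rightarrow> ('b \<Rightarrow> 'a set) \<Rightarrow> bool" where
  "tree_decomposition G T B \<longleftrightarrow>
     undirected_tree T \<and>
     (\<Union>t\<in>pverts T. B t) = pverts G \<and>
     (\<forall>(v, w)\<in>parcs G. \<exists>t\<in>pverts T. v \<in> B t \<and> w \<in> B t) \<and>
     (\<forall>v\<in>pverts G. connected (with_proj T \<restriction> {t \<in> pverts T. v \<in> B t}))"

text \<open>
  Truncated subtraction matters only for the empty graph, which gets width 0 instead of -1.
\<close>

definition decomposition_width :: "'b pair_pre_digraph \<Rightarrow> ('b \<Rightarrow> 'a set) \<Rightarrow> nat" where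
  "decomposition_width T B = Max ((\<lambda>t. card (B t)) ` pverts T) - 1"

text \<open>
  Decomposition trees are finite, so it is no restriction to take natural numbers as their nodes.
\<close>

definition tree_width :: "'a pair_pre_digraph \<Rightarrow> nat" where
  "tree_width G =
     (LEAST w. \<exists>(T :: nat pair_pre_digraph) B.
        tree_decomposition G T B \<and> decomposition_width T B = w)"

text \<open>The minima in \<^const>\<open>track_number\<close> and \<^const>\<open>tree_width\<close> are taken over non-empty sets.\<close>

lemma ex_track_layout:
  assumes "pair_graph G"
  shows "\<exists>t P r. track_layout G t P r"
proof -
  interpret pair_graph G by fact
  let ?P = "(\<lambda>v. {v}) ` pverts G"
  have "partition_on (pverts G) ?P"
    by (auto simp: partition_on_def disjoint_def)
  moreover have "(v, v) \<notin> parcs G" for v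
    using pair_no_loops by fastforce
  ultimately have "track_layout G (card ?P) ?P (\<lambda>_. {})"
    using pair_finite_verts
    by (auto simp: track_layout_def track_assignment_def is_colouring_def has_X_crossing_def
        strict_linear_order_on_def total_on_def irrefl_def)
  then show ?thesis by blast
qed

lemma ex_tree_decomposition:
  assumes "pair_graph G"
  shows "\<exists>(T :: nat pair_pre_digraph) B. tree_decomposition G T B"
proof -
  interpret pair_graph G by fact
  let ?T = "\<lparr>pverts = {0 :: nat}, parcs = {}\<rparr>"
  have T: "pair_graph ?T"
    by unfold_locales (auto simp: symmetric_def sym_def)
  have con: "connected (with_proj ?T)"
    by (auto simp: connected_def strongly_connected_def reachable_def)
  have "\<not> pre_digraph.cycle (with_proj ?T) p" for p
    by (auto simp: pre_digraph.cycle_def pre_digraph.awalk_def)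
  with T con have "undirected_tree ?T"
    by (auto simp: undirected_tree_def)
  moreover have "connected (with_proj ?T \<restriction> {0})"
    using con by (simp add: induce_subgraph_def with_proj_def)
  ultimately have "tree_decomposition G ?T (\<lambda>_. pverts G)"
    by (auto simp: tree_decomposition_def in_arcsD1 in_arcsD2)
  then show ?thesis by blast
qed

end

theory Submission
  imports Defs
begin

text \<open>
  By induction on \<open>s\<close> there is a graph with bags of size at most \<open>s\<close> that needs \<open>0 + 1 + \<dots> + s\<close>
  tracks. For the step, join a clique \<open>A\<close> of size \<open>s\<close> to many independent vertices \<open>b\<close>, and join each
  \<open>b\<close> to its own copy of the previous graph. If there are few tracks, then three vertices \<open>x < y < z\<close>
  of the second kind share a track. A vertex \<open>v\<close> of the copy at \<open>y\<close> cannot share a track with \<open>a \<in> A\<close>: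
  \<open>v < a\<close> makes \<open>vy\<close> and \<open>ax\<close> cross, and \<open>a < v\<close> makes \<open>az\<close> and \<open>vy\<close> cross. So this copy avoids the
  \<open>s\<close> tracks of \<open>A\<close> as well as the track of \<open>y\<close>.

  The exact value is reached by discarding vertices from the end of a perfect elimination ordering:
  this preserves the bound on the tree-width and lowers the track-number by at most one per vertex.
\<close>

section \<open>Track layouts as colour functions\<close>

text \<open>The tracks are the fibres of \<open>col\<close>, so colours may be of any type: this
  allows pulling a layout back along an embedding and adding a fresh track. A single relation
  \<open>lt\<close> carries all the orders and is constrained only inside fibres. In
  \<open>no_crossing\<close> the two tracks are distinct because of \<open>proper\<close>.\<close>

locale track_colouring =
  fixes G :: "'a pair_pre_digraph" and col :: "'a \<Rightarrow> 'c" and lt :: "'a \<Rightarrow> 'a \<Rightarrow> bool"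
  assumes proper: "(v, w) \<in> parcs G \<Longrightarrow> col v \<noteq> col w"
    and irrefl: "v \<in> pverts G \<Longrightarrow> \<not> lt v v"
    and trans: "\<lbrakk>u \<in> pverts G; v \<in> pverts G; w \<in> pverts G; col u = col v; col v = col w; lt u v; lt v w\<rbrakk>
      \<Longrightarrow> lt u w"
    and total: "\<lbrakk>v \<in> pverts G; w \<in> pverts G; v \<noteq> w; col v = col w\<rbrakk> \<Longrightarrow> lt v w \<or> lt w v"
    and no_crossing: "\<lbrakk>(v, w) \<in> parcs G; (x, y) \<in> parcs G; col v = col x; col w = col y; lt v x; lt y w\<rbrakk>
      \<Longrightarrow> False"

lemma track_layout_imp_track_colouring:
  assumes G: "pair_graph G" and layout: "track_layout G t P r"
  obtains col :: "'a \<Rightarrow> 'a set" and lt where "track_colouring G col lt" "card (col ` pverts G) = t"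
proof -
  interpret pair_graph G by fact
  \<comment> \<open>The orders of all classes are glued together. As each vertex lies in exactly one
    class, on vertices this relation restricts to the given order of that class, as
    \<open>lt_col\<close> records.\<close>
  define lt where "lt v w \<longleftrightarrow> (\<exists>V\<in>P. (v, w) \<in> r V)" for v w
  have part: "partition_on (pverts G) P"
    and indep: "\<And>V v w. V \<in> P \<Longrightarrow> v \<in> V \<Longrightarrow> w \<in> V \<Longrightarrow> (v, w) \<notin> parcs G"
    and r: "\<And>V. V \<in> P \<Longrightarrow> r V \<subseteq> V \<times> V \<and> strict_linear_order_on V (r V)"
    and cardP: "card P = t" and noX: "\<not> has_X_crossing G P r"
    using layout by (auto simp: track_layout_def track_assignment_def is_colouring_def)
  have "\<forall>v. \<exists>V. v \<in> pverts G \<longrightarrow> V \<in> P \<and> v \<in> V"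
    using part by (auto simp: partition_on_def)
  then obtain col where col: "\<And>v. v \<in> pverts G \<Longrightarrow> col v \<in> P \<and> v \<in> col v"
    by metis
  have uniq: "V = col v" if "V \<in> P" "v \<in> V" for v V
    using that col[of v] part unfolding partition_on_def disjoint_def by blast
  have verts: "v \<in> pverts G" if "V \<in> P" "v \<in> V" for v V
    using that part by (auto simp: partition_on_def)
  have lt_col: "lt v w \<longleftrightarrow> (v, w) \<in> r (col v)" "lt v w \<Longrightarrow> col v = col w"
    if "v \<in> pverts G" for v w
    using r uniq col that unfolding lt_def by blast+
  have "col ` pverts G = P"
  proof
    show "P \<subseteq> col ` pverts G"
    proof
      fix V assume "V \<in> P"
      moreover from this obtain v where "v \<in> V"
        using part by (metis all_not_in_conv partition_on_def)
      ultimately show "V \<in> col ` pverts G"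
        using uniq verts by blast
    qed
  qed (use col in auto)
  moreover have "track_colouring G col lt"
  proof (unfold_locales; (rule notI disjCI)?)
    fix v w assume "(v, w) \<in> parcs G" "col v = col w"
    then show False
      using indep col in_arcsD1 in_arcsD2 by metis
  next
    fix v assume "v \<in> pverts G" "lt v v"
    then show False
      using r col lt_col unfolding strict_linear_order_on_def irrefl_def by metis
  next
    fix u v w
    assume *: "u \<in> pverts G" "v \<in> pverts G" "w \<in> pverts G" "col u = col v" "col v = col w"
      "lt u v" "lt v w"
    then have "trans (r (col u))" "(u, v) \<in> r (col u)" "(v, w) \<in> r (col u)"
      using r col lt_col unfolding strict_linear_order_on_def by metis+
    then show "lt u w"
      using * lt_col by (meson transD)
  next
    fix v w assume *: "v \<in> pverts G" "w \<in> pverts G" "v \<noteq> w" "col v = col w" "\<not> lt w v"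
    then have "total_on (col v) (r (col v))" "v \<in> col v" "w \<in> col v"
      using r col unfolding strict_linear_order_on_def by metis+
    then show "lt v w"
      using * lt_col unfolding total_on_def by metis
  next
    fix v w x y
    assume *: "(v, w) \<in> parcs G" "(x, y) \<in> parcs G" "col v = col x" "col w = col y"
      "lt v x" "lt y w"
    then have V: "v \<in> pverts G" "w \<in> pverts G" "x \<in> pverts G" "y \<in> pverts G"
      using in_arcsD1 in_arcsD2 by blast+
    have "col v \<noteq> col w"
      using indep col V * by metis
    moreover have "(v, x) \<in> r (col v)" "(y, w) \<in> r (col w)"
      using lt_col V * by metis+
    ultimately have "has_X_crossing G P r"
      unfolding has_X_crossing_def using col V * by metis
    with noX show False ..
  qed
  ultimately show thesis
    using that cardP by metis
qed

lemma track_colouring_imp_track_layout: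
  assumes G: "pair_graph G" and tc: "track_colouring G col lt"
  shows "\<exists>P r. track_layout G (card (col ` pverts G)) P r"
proof -
  interpret pair_graph G by fact
  \<comment> \<open>Only fibres over colours that occur become classes, so none is empty and their
    number is the number of colours used.\<close>
  define cls where "cls c = {v \<in> pverts G. col v = c}" for c
  define P where "P = cls ` col ` pverts G"
  define r where "r V = {(v, w). v \<in> V \<and> w \<in> V \<and> lt v w}" for V
  interpret tc: track_colouring G col lt by fact
  have "inj_on cls (col ` pverts G)"
    by (rule inj_onI) (auto simp: cls_def)
  then have "card P = card (col ` pverts G)"
    unfolding P_def by (rule card_image)
  moreover have "finite P"
    using pair_finite_verts by (simp add: P_def)
  moreover have "is_colouring G P"
    unfolding is_colouring_def
  proof
    show "partition_on (pverts G) P"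
      by (auto simp: partition_on_def disjoint_def P_def cls_def)
    show "\<forall>V\<in>P. \<forall>v\<in>V. \<forall>w\<in>V. (v, w) \<notin> parcs G"
      using tc.proper by (fastforce simp: P_def cls_def)
  qed
  moreover have "r V \<subseteq> V \<times> V \<and> strict_linear_order_on V (r V)" if "V \<in> P" for V
  proof -
    obtain c where V: "V = cls c"
      using \<open>V \<in> P\<close> by (auto simp: P_def)
    have "trans (r V)"
    proof (rule transI)
      fix x y z assume "(x, y) \<in> r V" "(y, z) \<in> r V"
      then show "(x, z) \<in> r V"
        using tc.trans[of x y z] by (auto simp: r_def V cls_def)
    qed
    moreover have "irrefl (r V)"
      using tc.irrefl by (auto simp: irrefl_def r_def V cls_def)
    moreover have "total_on V (r V)"
      using tc.total by (auto simp: total_on_def r_def V cls_def)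
    ultimately show ?thesis
      by (auto simp: strict_linear_order_on_def r_def)
  qed
  moreover have "\<not> has_X_crossing G P r"
  proof
    assume "has_X_crossing G P r"
    then obtain V W v w x y where "V \<in> P" "W \<in> P" "v \<in> V" "x \<in> V" "w \<in> W" "y \<in> W"
      "(v, w) \<in> parcs G" "(x, y) \<in> parcs G" "lt v x" "lt y w"
      unfolding has_X_crossing_def r_def by blast
    then show False
      using tc.no_crossing[of v w x y] by (auto simp: P_def cls_def)
  qed
  ultimately show ?thesis
    unfolding track_layout_def track_assignment_def by metis
qed

lemma track_number_le:
  assumes "pair_graph G" "track_colouring G col lt"
  shows "track_number G \<le> card (col ` pverts G)"
  unfolding track_number_def
  using track_colouring_imp_track_layout[OF assms] by (rule Least_le)

lemma obtain_track_colouring: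
  assumes "pair_graph G"
  obtains col :: "'a \<Rightarrow> 'a set" and lt
  where "track_colouring G col lt" "card (col ` pverts G) = track_number G"
proof -
  have "\<exists>P r. track_layout G (track_number G) P r"
    unfolding track_number_def using ex_track_layout[OF assms] by (rule LeastI_ex)
  then show thesis
    using track_layout_imp_track_colouring[OF assms] that by metis
qed

text \<open>Used to restrict a layout to an embedded copy of a smaller graph. A crossing in
  \<open>G\<close> would be mapped to a crossing in \<open>H\<close>, and injectivity of
  \<open>f\<close> transfers totality. The colour type stays the same.\<close>

lemma track_colouring_pullback:
  assumes tc: "track_colouring H col lt"
    and f: "inj_on f (pverts G)" "f ` pverts G \<subseteq> pverts H"
    and arcs: "\<And>v w. (v, w) \<in> parcs G \<Longrightarrow> (f v, f w) \<in> parcs H"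
  shows "track_colouring G (col \<circ> f) (\<lambda>v w. lt (f v) (f w))"
proof -
  interpret tc: track_colouring H col lt by fact
  have V: "f v \<in> pverts H" if "v \<in> pverts G" for v
    using that f by auto
  show ?thesis
  proof (unfold_locales; (rule notI disjCI)?)
    fix v w assume "(v, w) \<in> parcs G" "(col \<circ> f) v = (col \<circ> f) w"
    then show False using tc.proper arcs by simp
  next
    fix v assume "v \<in> pverts G" "lt (f v) (f v)"
    then show False using tc.irrefl V by blast
  next
    fix u v w
    assume "u \<in> pverts G" "v \<in> pverts G" "w \<in> pverts G"
      "(col \<circ> f) u = (col \<circ> f) v" "(col \<circ> f) v = (col \<circ> f) w" "lt (f u) (f v)" "lt (f v) (f w)"
    then show "lt (f u) (f w)" using tc.trans[of "f u" "f v" "f w"] V by simp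
  next
    fix v w
    assume "v \<in> pverts G" "w \<in> pverts G" "v \<noteq> w" "(col \<circ> f) v = (col \<circ> f) w" "\<not> lt (f w) (f v)"
    then show "lt (f v) (f w)" using tc.total[of "f v" "f w"] V f(1) by (auto dest: inj_onD)
  next
    fix v w x y
    assume "(v, w) \<in> parcs G" "(x, y) \<in> parcs G" "(col \<circ> f) v = (col \<circ> f) x"
      "(col \<circ> f) w = (col \<circ> f) y" "lt (f v) (f x)" "lt (f y) (f w)"
    then show False using tc.no_crossing[of "f v" "f w" "f x" "f y"] arcs by simp
  qed
qed

section \<open>The lower bound\<close>

lemma three_in_a_fibre:
  assumes fin: "finite B" and card: "2 * card (col ` B) < card B"
  obtains x y z where "{x, y, z} \<subseteq> B" "distinct [x, y, z]" "col x = col y" "col y = col z"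
proof -
  have "\<exists>c \<in> col ` B. 2 < card (B \<inter> col -` {c})"
  proof (rule ccontr)
    assume "\<not> ?thesis"
    then have *: "card (B \<inter> col -` {c}) \<le> 2" if "c \<in> col ` B" for c
      using that by (auto simp: not_less)
    have "B = (\<Union>c \<in> col ` B. B \<inter> col -` {c})"
      by auto
    then have "card B \<le> (\<Sum>c \<in> col ` B. card (B \<inter> col -` {c}))"
      using fin by (metis card_UN_le finite_imageI)
    also have "\<dots> \<le> (\<Sum>c \<in> col ` B. 2)"
      using * by (intro sum_mono)
    finally show False
      using card by simp
  qed
  then obtain c where "2 < card (B \<inter> col -` {c})"
    by blast
  then have "3 \<le> card (B \<inter> col -` {c})"
    by simp
  then obtain T where "T \<subseteq> B \<inter> col -` {c}" "card T = 3"
    by (meson obtain_subset_with_card_n)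
  then show thesis
    using that by (auto simp: card_3_iff)
qed

text \<open>The inductive step in abstract form; \<open>f b\<close> embeds \<open>G\<close> among
  the neighbours of \<open>b\<close> and outside \<open>A\<close>. For a suitable \<open>y\<close>
  in \<open>B\<close>, three disjoint sets of colours are counted: \<open>card A\<close> on the
  clique, at least \<open>m\<close> on the copy at \<open>y\<close>, and the colour of
  \<open>y\<close> itself.\<close>

lemma track_colouring_lower_bound:
  fixes col :: "'a \<Rightarrow> 'c" and G :: "'b pair_pre_digraph"
  assumes H: "pair_graph H" and tc: "track_colouring H col lt"
    and A: "A \<subseteq> pverts H" "\<And>a a'. a \<in> A \<Longrightarrow> a' \<in> A \<Longrightarrow> a \<noteq> a' \<Longrightarrow> (a, a') \<in> parcs H"
    and B: "B \<subseteq> pverts H" "\<And>a b. a \<in> A \<Longrightarrow> b \<in> B \<Longrightarrow> (a, b) \<in> parcs H"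
    and f: "\<And>b. b \<in> B \<Longrightarrow> inj_on (f b) (pverts G)"
      "\<And>b v w. b \<in> B \<Longrightarrow> (v, w) \<in> parcs G \<Longrightarrow> (f b v, f b w) \<in> parcs H"
      "\<And>b v. b \<in> B \<Longrightarrow> v \<in> pverts G \<Longrightarrow> (b, f b v) \<in> parcs H"
      "\<And>b v. b \<in> B \<Longrightarrow> v \<in> pverts G \<Longrightarrow> f b v \<notin> A"
    and G: "\<And>(col :: 'b \<Rightarrow> 'c) lt. track_colouring G col lt \<Longrightarrow> m \<le> card (col ` pverts G)"
    and large: "2 * (m + card A) < card B"
  shows "m + card A < card (col ` pverts H)"
proof (rule ccontr)
  assume few: "\<not> ?thesis"
  interpret H: pair_graph H by fact
  interpret tc: track_colouring H col lt by fact
  have sym: "(w, v) \<in> parcs H" if "(v, w) \<in> parcs H" for v w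
    using that arcs_ends_symmetric[OF H.pair_sym_arcs] by simp
  have "finite B"
    using B(1) H.pair_finite_verts finite_subset by blast
  moreover have "card (col ` B) \<le> card (col ` pverts H)"
    using B(1) H.pair_finite_verts by (intro card_mono) auto
  ultimately obtain b1 b2 b3 where b: "{b1, b2, b3} \<subseteq> B" "distinct [b1, b2, b3]"
    "col b1 = col b2" "col b2 = col b3"
    using large few three_in_a_fibre[of B col] by auto
  \<comment> \<open>Sorting the three vertices along their common track gives the middle one the
    name \<open>y\<close>.\<close>
  obtain x y z where xyz: "x \<in> B" "y \<in> B" "z \<in> B" "col x = col y" "col z = col y" "lt x y" "lt y z"
  proof -
    have "lt b1 b2 \<or> lt b2 b1" "lt b1 b3 \<or> lt b3 b1" "lt b2 b3 \<or> lt b3 b2"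
      using b B(1) tc.total[of b1 b2] tc.total[of b1 b3] tc.total[of b2 b3] by auto
    with b that show thesis
      by (metis insert_subset)
  qed
  let ?C = "f y ` pverts G"
  have CH: "?C \<subseteq> pverts H"
    using f(3) xyz(2) H.in_arcsD2 by blast
  have "m \<le> card ((col \<circ> f y) ` pverts G)"
    using track_colouring_pullback[OF tc f(1) CH f(2)] xyz(2) G by blast
  then have cardC: "m \<le> card (col ` ?C)"
    by (simp add: image_comp)
  have "inj_on col A"
    using A(2) tc.proper by (meson inj_onI)
  then have cardA: "card (col ` A) = card A"
    by (rule card_image)
  have "col a \<noteq> col (f y v)" if a: "a \<in> A" and v: "v \<in> pverts G" for a v
  proof
    assume eq: "col a = col (f y v)"
    have arcs: "(a, x) \<in> parcs H" "(a, y) \<in> parcs H" "(a, z) \<in> parcs H" "(f y v, y) \<in> parcs H"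
      using a v xyz B(2) f(3) sym by blast+
    have "lt a (f y v) \<or> lt (f y v) a"
      using a v A(1) CH eq f(4) xyz(2) by (intro tc.total) auto
    \<comment> \<open>If \<open>f y v\<close> precedes \<open>a\<close>, the first instance applies
      with \<open>lt x y\<close>; if \<open>a\<close> precedes \<open>f y v\<close>, the second
      applies with \<open>lt y z\<close>.\<close>
    then show False
      using tc.no_crossing[OF arcs(4) arcs(1)] tc.no_crossing[OF arcs(3) arcs(4)] eq xyz by auto
  qed
  then have "col ` A \<inter> col ` ?C = {}"
    by auto
  \<comment> \<open>The vertex \<open>y\<close> is adjacent to all of \<open>A\<close> and to its
    whole copy.\<close>
  moreover have "col y \<notin> col ` A \<union> col ` ?C"
    using tc.proper B(2) f(3) xyz(2) by fastforce
  moreover have "finite A" "finite ?C"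
    using A(1) CH H.pair_finite_verts finite_subset by blast+
  ultimately have "card (insert (col y) (col ` A \<union> col ` ?C)) = Suc (card (col ` A) + card (col ` ?C))"
    by (simp add: card_Un_disjoint)
  moreover have "card (insert (col y) (col ` A \<union> col ` ?C)) \<le> card (col ` pverts H)"
    using A(1) B(1) CH xyz(2) H.pair_finite_verts by (intro card_mono) auto
  ultimately show False
    using few cardA cardC by simp
qed

section \<open>Graphs with a perfect elimination ordering\<close>

text \<open>\<open>E\<close> is meant to contain pairs with the smaller vertex first, so that the
  elimination ordering is the order of the naturals and deleting the last vertices just lowers
  \<open>n\<close>.\<close>

definition ordered_graph :: "nat rel \<Rightarrow> nat \<Rightarrow> nat pair_pre_digraph" where
  "ordered_graph E n = \<lparr>pverts = {..<n}, parcs = {(u, v). u < n \<and> v < n \<and> ((u, v) \<in> E \<or> (v, u) \<in> E)}\<rparr>"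

lemma ordered_graph_simps [simp]:
  "pverts (ordered_graph E n) = {..<n}"
  "(u, v) \<in> parcs (ordered_graph E n) \<longleftrightarrow> u < n \<and> v < n \<and> ((u, v) \<in> E \<or> (v, u) \<in> E)"
  by (auto simp: ordered_graph_def)

lemma pair_graph_ordered_graph:
  assumes "E \<subseteq> less_than"
  shows "pair_graph (ordered_graph E n)"
proof
  show "finite (parcs (ordered_graph E n))"
    by (rule finite_subset[of _ "{..<n} \<times> {..<n}"]) auto
  show "symmetric (with_proj (ordered_graph E n))"
    by (auto simp: symmetric_def sym_def)
qed (use assms in auto)

text \<open>The new vertex \<open>n\<close> gets a track of its own, and a track with a single
  vertex takes part in no X-crossing.\<close>

lemma track_number_ordered_graph_Suc:
  assumes E: "E \<subseteq> less_than"
  shows "track_number (ordered_graph E (Suc n)) \<le> Suc (track_number (ordered_graph E n))"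
proof -
  let ?G = "ordered_graph E n" and ?H = "ordered_graph E (Suc n)"
  note G = pair_graph_ordered_graph[OF E]
  obtain col :: "nat \<Rightarrow> nat set" and lt
    where tc: "track_colouring ?G col lt" and card: "card (col ` pverts ?G) = track_number ?G"
    using obtain_track_colouring[OF G] .
  \<comment> \<open>\<open>None\<close> is the extra track. Since \<open>lt'\<close> relates only
    vertices below \<open>n\<close>, any crossing would already be one among the old
    vertices.\<close>
  define col' where "col' v = (if v < n then Some (col v) else None)" for v
  define lt' where "lt' v w \<longleftrightarrow> v < n \<and> w < n \<and> lt v w" for v w
  interpret tc: track_colouring ?G col lt by fact
  have "track_colouring ?H col' lt'"
  proof (unfold_locales; (rule notI disjCI)?)
    fix v w assume "(v, w) \<in> parcs ?H" "col' v = col' w"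
    then show False
      using tc.proper[of v w] E by (auto simp: col'_def split: if_splits dest: less_antisym)
  next
    fix v assume "v \<in> pverts ?H" "lt' v v"
    then show False using tc.irrefl by (auto simp: lt'_def)
  next
    fix u v w
    assume "col' u = col' v" "col' v = col' w" "lt' u v" "lt' v w"
    then show "lt' u w" using tc.trans[of u v w] by (auto simp: lt'_def col'_def)
  next
    fix v w
    assume "v \<in> pverts ?H" "w \<in> pverts ?H" "v \<noteq> w" "col' v = col' w" "\<not> lt' w v"
    then show "lt' v w"
      using tc.total[of v w] by (auto simp: lt'_def col'_def split: if_splits)
  next
    fix v w x y
    assume "(v, w) \<in> parcs ?H" "(x, y) \<in> parcs ?H" "col' v = col' x" "col' w = col' y"
      "lt' v x" "lt' y w"
    then show False
      using tc.no_crossing[of v w x y] by (auto simp: lt'_def col'_def)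
  qed
  then have "track_number ?H \<le> card (col' ` pverts ?H)"
    using track_number_le[OF G] by blast
  also have "col' ` pverts ?H = insert None (Some ` col ` pverts ?G)"
    by (auto simp: col'_def image_iff less_Suc_eq)
  also have "card \<dots> \<le> Suc (card (Some ` col ` pverts ?G))"
    by (simp add: card_insert_if)
  also have "card (Some ` col ` pverts ?G) = track_number ?G"
    using card by (simp add: card_image)
  finally show ?thesis by simp
qed

lemma track_number_ordered_graph_0: "track_number (ordered_graph E 0) = 0"
proof -
  have "track_colouring (ordered_graph E 0) id (\<lambda>_ _. False)"
    by unfold_locales auto
  moreover have "pair_graph (ordered_graph E 0)"
    using pair_graph_ordered_graph[of "{}" 0] by (simp add: ordered_graph_def)
  ultimately show ?thesis
    using track_number_le by fastforce
qed

text \<open>A discrete intermediate value argument: the track-number starts at 0 and rises by at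
  most one per vertex, so it skips no value.\<close>

lemma ex_ordered_graph_track_number:
  assumes E: "E \<subseteq> less_than"
  shows "t \<le> track_number (ordered_graph E n) \<Longrightarrow> \<exists>m\<le>n. track_number (ordered_graph E m) = t"
proof (induction n)
  case 0
  then show ?case
    by (simp add: track_number_ordered_graph_0)
next
  case (Suc n)
  show ?case
  proof (cases "t \<le> track_number (ordered_graph E n)")
    case True
    then show ?thesis using Suc.IH le_SucI by blast
  next
    case False
    then have "track_number (ordered_graph E (Suc n)) = t"
      using track_number_ordered_graph_Suc[OF E, of n] Suc.prems by simp
    then show ?thesis by blast
  qed
qed

section \<open>Decomposition trees given by parent functions\<close>

definition parent_tree :: "(nat \<Rightarrow> nat) \<Rightarrow> nat \<Rightarrow> nat pair_pre_digraph" where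
  "parent_tree par n = ordered_graph {(par v, v) |v. 0 < v} n"

lemma pcas_nth:
  assumes "pcas u p v" "i < length p"
  shows "fst (p ! i) = (if i = 0 then u else snd (p ! (i - 1)))"
  using assms by (induction p arbitrary: u i) (auto simp: nth_Cons split: nat.splits)

lemma pcas_last: "pcas u p v \<Longrightarrow> p \<noteq> [] \<Longrightarrow> snd (last p) = v"
  by (induction p arbitrary: u) auto

text \<open>The two neighbours of the largest vertex of a cycle would both be its parent.\<close>

lemma parent_tree_no_cycle:
  assumes par: "\<And>v. 0 < v \<Longrightarrow> par v < v" and len: "3 \<le> length p"
  shows "\<not> pre_digraph.cycle (with_proj (parent_tree par n)) p"
proof
  assume "pre_digraph.cycle (with_proj (parent_tree par n)) p"
  then obtain u where arcs: "set p \<subseteq> parcs (parent_tree par n)" and cas: "pcas u p u"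
    and "distinct (tl (pawalk_verts u p))"
    by (auto simp: pre_digraph.cycle_def pre_digraph.awalk_def cas_with_proj_eq awalk_verts_with_proj_eq)
  moreover have "pawalk_verts u p = u # map snd p" if "pcas u p v" for v
    using that by (induction p arbitrary: u) auto
  ultimately have dist: "distinct (map snd p)"
    by simp
  \<comment> \<open>The cyclic predecessor of a position; below, \<open>j\<close> is the cyclic
    successor of the position \<open>i\<close> whose arc ends in the maximum
    \<open>M\<close>.\<close>
  let ?prev = "\<lambda>i. (if i = 0 then length p else i) - 1"
  have fst_nth: "fst (p ! i) = snd (p ! ?prev i)" if "i < length p" for i
  proof -
    have "snd (p ! (length p - 1)) = u"
      using pcas_last[OF cas] len last_conv_nth[of p] by fastforce
    then show ?thesis
      using pcas_nth[OF cas that] by simp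
  qed
  define M where "M = Max (snd ` set p)"
  have le_M: "snd (p ! i) \<le> M" if "i < length p" for i
    using that by (simp add: M_def)
  have "M \<in> snd ` set p"
    unfolding M_def using len by (intro Max_in) auto
  then obtain i where i: "i < length p" "snd (p ! i) = M"
    by (auto simp: in_set_conv_nth)
  define j where "j = (if Suc i = length p then 0 else Suc i)"
  \<comment> \<open>Here the length of at least 3 matters: it makes the positions before and after
    \<open>i\<close> different, hence also the two neighbours of \<open>M\<close> on the
    cycle.\<close>
  have j: "j < length p" "?prev j = i" "j \<noteq> ?prev i" "?prev i < length p"
    using i len by (auto simp: j_def)
  have nb: "w = par M" if "w \<le> M" "(w, M) \<in> parcs (parent_tree par n) \<or> (M, w) \<in> parcs (parent_tree par n)"
    for w
    using that par[of M] par[of w] by (auto simp: parent_tree_def)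
  have "p ! i \<in> parcs (parent_tree par n)" "p ! j \<in> parcs (parent_tree par n)"
    using arcs i(1) j(1) nth_mem by blast+
  moreover have "p ! i = (snd (p ! ?prev i), M)" "p ! j = (M, snd (p ! j))"
    using fst_nth i j by (metis prod.collapse)+
  ultimately have "snd (p ! ?prev i) = par M" "snd (p ! j) = par M"
    using nb le_M j by metis+
  then have "map snd p ! j = map snd p ! ?prev i"
    using j by simp
  then show False
    using dist j by (metis length_map nth_eq_iff_index_eq)
qed

text \<open>Following parents from any vertex of \<open>S\<close> strictly descends without leaving
  \<open>S\<close>, so it ends in \<open>r\<close>. This serves both for the whole tree and for the
  set of nodes whose bags contain a given vertex.\<close>

lemma connected_parent_tree_restrict:
  assumes S: "S \<subseteq> {..<n}" "r \<in> S"
    and par: "\<And>v. v \<in> S \<Longrightarrow> v \<noteq> r \<Longrightarrow> 0 < v \<and> par v < v \<and> par v \<in> S"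
  shows "connected (with_proj (parent_tree par n) \<restriction> S)"
proof -
  let ?T = "with_proj (parent_tree par n) \<restriction> S"
  have parcs: "(v, w) \<in> parcs (mk_symmetric ?T)"
    if "v \<in> S" "w \<in> S" "(v, w) \<in> parcs (parent_tree par n)" for v w
    using that by (force simp: mk_symmetric_def)
  have wf: "wf_digraph (with_proj (mk_symmetric ?T))"
    by unfold_locales (auto simp: mk_symmetric_def)
  have to_root: "v \<rightarrow>\<^sup>*\<^bsub>with_proj (mk_symmetric ?T)\<^esub> r" if "v \<in> S" for v
    using that
  proof (induction v rule: less_induct)
    case (less v)
    show ?case
    proof (cases "v = r")
      case True
      then show ?thesis
        using S by (auto simp: reachable_def)
    next
      case False
      then have "par v \<rightarrow>\<^sup>*\<^bsub>with_proj (mk_symmetric ?T)\<^esub> r" "(v, par v) \<in> parcs (mk_symmetric ?T)"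
        using less S par[of v] parcs[of v "par v"] by (auto simp: parent_tree_def)
      then show ?thesis
        using wf_digraph.adj_reachable_trans[OF wf] by simp
    qed
  qed
  moreover have "r \<rightarrow>\<^sup>*\<^bsub>with_proj (mk_symmetric ?T)\<^esub> v" if "v \<in> S" for v
    using that by (rule symmetric_reachable[OF symmetric_mk_symmetric to_root])
  ultimately have "v \<rightarrow>\<^sup>*\<^bsub>with_proj (mk_symmetric ?T)\<^esub> w" if "v \<in> S" "w \<in> S" for v w
    using that wf_digraph.reachable_trans[OF wf] by metis
  then show ?thesis
    unfolding connected_def using S by (intro strongly_connectedI) auto
qed

lemma undirected_tree_parent_tree:
  assumes par: "\<And>v. 0 < v \<Longrightarrow> par v < v" and n: "0 < n"
  shows "undirected_tree (parent_tree par n)"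
proof -
  have "pair_graph (parent_tree par n)"
    unfolding parent_tree_def using par by (intro pair_graph_ordered_graph) auto
  moreover have "with_proj (parent_tree par n) \<restriction> {..<n} = with_proj (parent_tree par n)"
    by (auto simp: induce_subgraph_def with_proj_def parent_tree_def)
  then have "connected (with_proj (parent_tree par n))"
    using connected_parent_tree_restrict[of "{..<n}" n 0 par] par n
    by (metis lessThan_iff less_trans neq0_conv order_refl)
  ultimately show ?thesis
    unfolding undirected_tree_def using parent_tree_no_cycle[OF par] by blast
qed

text \<open>The decomposition tree has the vertices themselves as nodes: the bag of \<open>v\<close> consists of \<open>v\<close>
  and its earlier neighbours, and its parent is the last of the latter.\<close>

lemma tree_width_perfect_elimination:
  assumes E: "E \<subseteq> less_than"
    and simplicial: "\<And>u v w. (u, w) \<in> E \<Longrightarrow> (v, w) \<in> E \<Longrightarrow> u < v \<Longrightarrow> (u, v) \<in> E"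
    and n: "0 < n" and card: "\<And>v. v < n \<Longrightarrow> card {u. (u, v) \<in> E} \<le> k"
  shows "tree_width (ordered_graph E n) \<le> k"
proof -
  let ?G = "ordered_graph E n"
  define nb where "nb v = {u. (u, v) \<in> E}" for v
  \<comment> \<open>A vertex without earlier neighbours is attached to the root 0, which keeps
    \<open>par v < v\<close> for all positive \<open>v\<close>.\<close>
  define par where "par v = (if nb v = {} then 0 else Max (nb v))" for v
  define bag where "bag v = insert v (nb v)" for v
  let ?T = "parent_tree par n"
  have verts [simp]: "pverts ?T = {..<n}"
    by (simp add: parent_tree_def)
  have nb_less: "u < v" if "u \<in> nb v" for u v
    using that E by (auto simp: nb_def)
  then have fin: "finite (nb v)" for v
    by (meson finite_nat_set_iff_bounded)
  have par_in: "par v \<in> nb v" if "nb v \<noteq> {}" for v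
    using that fin Max_in by (simp add: par_def)
  have par_less: "par v < v" if "0 < v" for v
    using that nb_less par_in by (cases "nb v = {}") (auto simp: par_def)
  \<comment> \<open>Simpliciality enters here: an earlier neighbour of \<open>v\<close> other than
    \<open>par v\<close> is also an earlier neighbour of \<open>par v\<close>.\<close>
  have nb_par: "u \<in> bag (par v)" if "u \<in> nb v" for u v
  proof (cases "u = par v")
    case False
    have "u \<le> par v"
      using that fin by (auto simp: par_def)
    with False have "u < par v" by simp
    moreover have "(u, v) \<in> E" "(par v, v) \<in> E"
      using that par_in by (auto simp: nb_def)
    ultimately have "(u, par v) \<in> E"
      by (intro simplicial[of u v "par v"])
    then show ?thesis
      by (simp add: bag_def nb_def)
  qed (simp add: bag_def)
  have "tree_decomposition ?G ?T bag"
    unfolding tree_decomposition_def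
  proof (intro conjI ballI)
    show "undirected_tree ?T"
      using par_less n by (rule undirected_tree_parent_tree)
    show "(\<Union>t\<in>pverts ?T. bag t) = pverts ?G"
      using nb_less by (fastforce simp: bag_def)
    show "case e of (v, w) \<Rightarrow> \<exists>t\<in>pverts ?T. v \<in> bag t \<and> w \<in> bag t" if "e \<in> parcs ?G" for e
      using that by (auto simp: bag_def nb_def)
    \<comment> \<open>The subtree of \<open>v\<close> has root \<open>v\<close>: any other node
      \<open>t\<close> in it has \<open>v\<close> as an earlier neighbour, and then
      \<open>nb_par\<close> puts \<open>v\<close> into the bag of the parent of
      \<open>t\<close>.\<close>
    show "connected (with_proj ?T \<restriction> {t \<in> pverts ?T. v \<in> bag t})" if "v \<in> pverts ?G" for v
    proof (rule connected_parent_tree_restrict)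
      show "v \<in> {t \<in> pverts ?T. v \<in> bag t}"
        using that by (simp add: bag_def)
      fix t assume "t \<in> {t \<in> pverts ?T. v \<in> bag t}" "t \<noteq> v"
      then have "t < n" "v \<in> nb t"
        by (auto simp: bag_def)
      then show "0 < t \<and> par t < t \<and> par t \<in> {t \<in> pverts ?T. v \<in> bag t}"
        using nb_less[of v t] par_less[of t] nb_par by auto
    qed auto
  qed
  then have "tree_width ?G \<le> decomposition_width ?T bag"
    unfolding tree_width_def by (intro Least_le) blast
  also have "\<dots> \<le> k"
  proof -
    have "card (bag v) \<le> Suc k" if "v < n" for v
      using card[OF that] fin by (simp add: bag_def nb_def card_insert_if)
    then have "Max ((\<lambda>t. card (bag t)) ` pverts ?T) \<le> Suc k"
      using n by (subst Max_le_iff) auto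
    then show ?thesis
      by (simp add: decomposition_width_def)
  qed
  finally show ?thesis .
qed

section \<open>The extremal graphs\<close>

text \<open>A clique on \<open>{..<s}\<close>, followed by blocks of length \<open>c\<close>. The first vertex of each block is joined
  to the whole clique and to its own block; the rest of the block carries a copy of \<open>E\<close>.\<close>

definition cone_blocks :: "nat \<Rightarrow> nat \<Rightarrow> nat rel \<Rightarrow> nat rel" where
  "cone_blocks s c E =
     {(u, v). u < v \<and> v < s} \<union>
     {(u, s + i * c) |u i. u < s} \<union>
     {(s + i * c, s + i * c + Suc j) |i j. Suc j < c} \<union>
     {(s + i * c + Suc h, s + i * c + Suc j) |i h j. Suc j < c \<and> (h, j) \<in> E}"

section \<open>Earlier neighbours in cone blocks\<close>

lemma block_unique:
  fixes c :: nat
  assumes "s + i * c + j = s + i' * c + j'" "j < c" "j' < c"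
  shows "i = i'" "j = j'"
proof -
  have "(j + i * c) div c = (j' + i' * c) div c"
    using assms(1) by (simp add: add.commute)
  then show "i = i'"
    using assms by simp
  then show "j = j'"
    using assms by simp
qed

lemma block_cases:
  fixes c :: nat
  assumes "0 < c"
  obtains (clique) "v < s" | (apex) i where "v = s + i * c" | (copy) i j where "Suc j < c" "v = s + i * c + Suc j"
proof (cases "v < s")
  case False
  then have v: "v = s + (v - s) div c * c + (v - s) mod c"
    by simp
  show thesis
  proof (cases "(v - s) mod c")
    case 0
    then show thesis using v that(2) by simp
  next
    case (Suc j)
    moreover have "(v - s) mod c < c"
      using assms by simp
    ultimately show thesis using v that(3) by simp
  qed
qed (use that in blast)

text \<open>This and the next two lemmas determine the earlier neighbours of the three kinds of
  vertices in \<open>block_cases\<close>; simpliciality and the size bound are read off from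
  them.\<close>

lemma cone_blocks_clique:
  "v < s \<Longrightarrow> (u, v) \<in> cone_blocks s c E \<longleftrightarrow> u < v"
  by (auto simp: cone_blocks_def)

lemma cone_blocks_apex:
  assumes "0 < c"
  shows "(u, s + i * c) \<in> cone_blocks s c E \<longleftrightarrow> u < s"
proof -
  have "s + i * c \<noteq> s + i' * c + Suc j" if "Suc j < c" for i' j
    using block_unique(2)[of s i c 0 i' "Suc j"] that assms by auto
  moreover have "\<not> s + i * c < s"
    by simp
  ultimately show ?thesis
    unfolding cone_blocks_def by blast
qed

lemma cone_blocks_copy:
  assumes j: "Suc j < c"
  shows "(u, s + i * c + Suc j) \<in> cone_blocks s c E \<longleftrightarrow>
    u = s + i * c \<or> (\<exists>h. u = s + i * c + Suc h \<and> (h, j) \<in> E)"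
proof -
  have "s + i * c + Suc j \<noteq> s + i' * c" for i'
    using block_unique(2)[of s i c "Suc j" i' 0] j by auto
  moreover have "i = i' \<and> j = j'" if "Suc j' < c" "s + i * c + Suc j = s + i' * c + Suc j'" for i' j'
    using block_unique[OF that(2) j that(1)] by simp
  moreover have "\<not> s + i * c + Suc j < s"
    by simp
  ultimately show ?thesis
    using j unfolding cone_blocks_def by blast
qed

lemma cone_blocks_less_than: "E \<subseteq> less_than \<Longrightarrow> cone_blocks s c E \<subseteq> less_than"
  by (auto simp: cone_blocks_def)

text \<open>The earlier neighbours of a clique vertex or an apex lie in the clique. Those of a
  copied vertex are its apex, which is joined to the whole block, and copied vertices, for which the
  claim is inherited from \<open>E\<close>.\<close>

lemma cone_blocks_simplicial:
  assumes E: "E \<subseteq> less_than" and c: "0 < c"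
    and simplicial: "\<And>u v w. (u, w) \<in> E \<Longrightarrow> (v, w) \<in> E \<Longrightarrow> u < v \<Longrightarrow> (u, v) \<in> E"
    and uw: "(u, w) \<in> cone_blocks s c E" and vw: "(v, w) \<in> cone_blocks s c E" and "u < v"
  shows "(u, v) \<in> cone_blocks s c E"
  using c
proof (cases rule: block_cases[of c w s])
  case clique
  then show ?thesis
    using assms by (simp add: cone_blocks_clique)
next
  case (apex i)
  then show ?thesis
    using assms by (simp add: cone_blocks_apex cone_blocks_clique)
next
  case (copy i j)
  then have u: "u = s + i * c \<or> (\<exists>h. u = s + i * c + Suc h \<and> (h, j) \<in> E)"
    and v: "v = s + i * c \<or> (\<exists>h. v = s + i * c + Suc h \<and> (h, j) \<in> E)"
    using uw vw cone_blocks_copy by metis+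
  \<comment> \<open>The later vertex \<open>v\<close> cannot be the apex, since every candidate for
    \<open>u\<close> is at least the apex.\<close>
  from u v \<open>u < v\<close> obtain h where h: "v = s + i * c + Suc h" "(h, j) \<in> E"
    by fastforce
  then have "Suc h < c"
    using E copy by auto
  moreover have "(h', h) \<in> E" if "u = s + i * c + Suc h'" "(h', j) \<in> E" for h'
    using that h \<open>u < v\<close> by (intro simplicial[of h' j h]) auto
  ultimately show ?thesis
    using u h(1) cone_blocks_copy by blast
qed

text \<open>A clique vertex has fewer than \<open>s\<close> earlier neighbours and an apex has
  exactly \<open>s\<close>. A copied vertex gains only its apex, whence the strict bound assumed for
  \<open>E\<close>.\<close>

lemma card_cone_blocks:
  assumes c: "0 < c" and E: "E \<subseteq> less_than"
    and card: "\<And>j. Suc j < c \<Longrightarrow> card {h. (h, j) \<in> E} < s"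
  shows "card {u. (u, v) \<in> cone_blocks s c E} \<le> s"
  using c
proof (cases rule: block_cases[of c v s])
  case clique
  then have "{u. (u, v) \<in> cone_blocks s c E} = {..<v}"
    by (auto simp: cone_blocks_clique)
  then show ?thesis
    using clique by simp
next
  case (apex i)
  then have "{u. (u, v) \<in> cone_blocks s c E} = {..<s}"
    using c by (auto simp: cone_blocks_apex)
  then show ?thesis by simp
next
  case (copy i j)
  let ?N = "{h. (h, j) \<in> E}"
  have "finite ?N"
    by (rule finite_subset[of _ "{..<j}"]) (use E in auto)
  moreover have "{u. (u, v) \<in> cone_blocks s c E} = insert (s + i * c) ((\<lambda>h. s + i * c + Suc h) ` ?N)"
    using copy by (auto simp: cone_blocks_copy simp del: add_Suc_right)
  ultimately have "card {u. (u, v) \<in> cone_blocks s c E} \<le> Suc (card ?N)"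
    by (simp add: card_insert_if card_image_le le_SucI)
  with card[OF copy(1)] show ?thesis by simp
qed

text \<open>An instance of \<open>track_colouring_lower_bound\<close>: the clique
  \<open>{..<s}\<close> is \<open>A\<close>, the block starts form \<open>B\<close>, and translation
  by \<open>a + 1\<close> embeds the copy belonging to the apex \<open>a\<close>.\<close>

lemma track_colouring_cone_blocks:
  assumes E: "E \<subseteq> less_than"
    and m: "\<And>(col :: nat \<Rightarrow> 'c) lt. track_colouring (ordered_graph E n) col lt \<Longrightarrow> m \<le> card (col ` {..<n})"
    and tc: "track_colouring (ordered_graph (cone_blocks s (Suc n) E) (s + b * Suc n)) col lt"
    and b: "2 * (m + s) < b"
  shows "m + s < card ((col :: nat \<Rightarrow> 'c) ` {..<s + b * Suc n})"
proof -
  define c where "c = Suc n"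
  have c: "0 < c" "Suc j < c \<longleftrightarrow> j < n" for j
    by (simp_all add: c_def)
  let ?H = "ordered_graph (cone_blocks s c E) (s + b * c)" and ?G = "ordered_graph E n"
  let ?B = "(\<lambda>i. s + i * c) ` {..<b}"
  have apex: "s + i * c < s + b * c" if "i < b" for i
    using that c by simp
  have copy: "s + i * c + Suc j < s + b * c" if "i < b" "j < n" for i j
  proof -
    have "i * c + Suc j < Suc i * c"
      using that c by simp
    also have "\<dots> \<le> b * c"
      using that by (intro mult_le_mono1) simp
    finally show ?thesis by simp
  qed
  have arcs: "(u, v) \<in> parcs ?H" "(v, u) \<in> parcs ?H"
    if "(u, v) \<in> cone_blocks s c E" "v < s + b * c" for u v
    using that cone_blocks_less_than[OF E] by fastforce+
  have "m + card {..<s} < card (col ` pverts ?H)"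
  proof (rule track_colouring_lower_bound[OF _ tc[folded c_def],
        where B = ?B and f = "\<lambda>a v. a + Suc v" and G = ?G])
    show "pair_graph ?H"
      by (intro pair_graph_ordered_graph cone_blocks_less_than E)
    show "(a, a') \<in> parcs ?H" if "a \<in> {..<s}" "a' \<in> {..<s}" "a \<noteq> a'" for a a'
      using that by (auto simp: cone_blocks_clique)
    show "(a, v) \<in> parcs ?H" if "a \<in> {..<s}" "v \<in> ?B" for a v
      using that apex c(1) cone_blocks_apex by (auto intro!: arcs(1))
    show "inj_on (\<lambda>v. a + Suc v) (pverts ?G)" for a
      by (auto intro: inj_onI)
    show "(a + Suc v, a + Suc w) \<in> parcs ?H" if a: "a \<in> ?B" and vw: "(v, w) \<in> parcs ?G" for a v w
    proof -
      obtain i where i: "i < b" "a = s + i * c"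
        using a by auto
      have "v < n" "w < n" and "(v, w) \<in> E \<or> (w, v) \<in> E"
        using vw by auto
      then have "(a + Suc v, a + Suc w) \<in> cone_blocks s c E \<or> (a + Suc w, a + Suc v) \<in> cone_blocks s c E"
        unfolding i(2) using cone_blocks_copy c(2) by metis
      moreover have "a + Suc v < s + b * c" "a + Suc w < s + b * c"
        unfolding i(2) using copy i(1) \<open>v < n\<close> \<open>w < n\<close> by blast+
      ultimately show ?thesis
        using arcs by blast
    qed
    show "(a, a + Suc v) \<in> parcs ?H" if a: "a \<in> ?B" and v: "v \<in> pverts ?G" for a v
    proof -
      obtain i where i: "i < b" "a = s + i * c"
        using a by auto
      have "v < n"
        using v by simp
      then show ?thesis
        unfolding i(2) using cone_blocks_copy c(2) i(1) by (intro arcs copy) blast+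
    qed
    show "2 * (m + card {..<s}) < card ?B"
      using b c(1) by (simp add: card_image inj_on_def)
  qed (use m apex in auto)
  then show ?thesis by (simp add: c_def)
qed

text \<open>The number of blocks exceeds \<open>2 * (\<Sum>{..s} + s)\<close>, so that three of their first vertices share a track
  in any layout with fewer than \<open>\<Sum>{..Suc s}\<close> tracks.\<close>

primrec extremal_size :: "nat \<Rightarrow> nat" where
  "extremal_size 0 = 0"
| "extremal_size (Suc s) = s + (2 * \<Sum>{..s} + 2 * s + 1) * Suc (extremal_size s)"

primrec extremal_arcs :: "nat \<Rightarrow> nat rel" where
  "extremal_arcs 0 = {}"
| "extremal_arcs (Suc s) = cone_blocks s (Suc (extremal_size s)) (extremal_arcs s)"

lemma extremal_arcs_less_than: "extremal_arcs s \<subseteq> less_than"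
  by (induction s) (auto intro!: cone_blocks_less_than simp del: less_than_iff)

lemma extremal_arcs_simplicial:
  "(u, w) \<in> extremal_arcs s \<Longrightarrow> (v, w) \<in> extremal_arcs s \<Longrightarrow> u < v \<Longrightarrow> (u, v) \<in> extremal_arcs s"
proof (induction s arbitrary: u v w)
  case (Suc s)
  note prems = Suc.prems[unfolded extremal_arcs.simps]
  show ?case
    unfolding extremal_arcs.simps
    by (rule cone_blocks_simplicial[OF extremal_arcs_less_than zero_less_Suc Suc.IH prems])
qed simp

lemma card_extremal_arcs: "v < extremal_size s \<Longrightarrow> card {u. (u, v) \<in> extremal_arcs s} < s"
proof (induction s arbitrary: v)
  case (Suc s)
  have "card {u. (u, v) \<in> cone_blocks s (Suc (extremal_size s)) (extremal_arcs s)} \<le> s"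
    using Suc.IH by (intro card_cone_blocks extremal_arcs_less_than) simp_all
  then show ?case
    by (simp add: less_Suc_eq_le)
qed simp

text \<open>The induction keeps the colour type fixed but leaves \<open>col\<close> and
  \<open>lt\<close> arbitrary, because the hypothesis is applied to colourings pulled back to
  copies.\<close>

lemma extremal_track_colouring:
  "track_colouring (ordered_graph (extremal_arcs s) (extremal_size s)) (col :: nat \<Rightarrow> 'c) lt \<Longrightarrow>
     \<Sum>{..s} \<le> card (col ` {..<extremal_size s})"
proof (induction s arbitrary: col lt)
  case (Suc s)
  let ?b = "2 * \<Sum>{..s} + 2 * s + 1"
  have "\<Sum>{..s} + s < card (col ` {..<s + ?b * Suc (extremal_size s)})"
    by (rule track_colouring_cone_blocks[OF extremal_arcs_less_than Suc.IH])
      (use Suc.prems in \<open>simp_all only: extremal_arcs.simps extremal_size.simps\<close>, simp_all)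
  \<comment> \<open>The strict inequality supplies the missing unit: \<Sum>{..s} + s + 1 equals
    \<Sum>{..Suc s}.\<close>
  then show ?case
    by simp
qed simp

theorem theorem7p4:
  fixes k :: nat
  shows "\<exists>G :: nat pair_pre_digraph.
           pair_graph G \<and> tree_width G \<le> k \<and>
           real (track_number G) = 1 / 2 * (real k + 1) * (real k + 2)"
proof -
  \<comment> \<open>Bags of size at most \<open>Suc k\<close> correspond to width at most
    \<open>k\<close>.\<close>
  let ?E = "extremal_arcs (Suc k)" and ?N = "extremal_size (Suc k)"
  note E = extremal_arcs_less_than[of "Suc k"]
  have "\<Sum>{..Suc k} \<le> track_number (ordered_graph ?E ?N)"
    using obtain_track_colouring[OF pair_graph_ordered_graph[OF E]] extremal_track_colouring
    by (metis ordered_graph_simps(1))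
  then obtain m where m: "m \<le> ?N" "track_number (ordered_graph ?E m) = \<Sum>{..Suc k}"
    using ex_ordered_graph_track_number[OF E] by blast
  \<comment> \<open>A decomposition tree has at least one node, so the vertex set indexing it must
    be non-empty; it is, since the target value is positive.\<close>
  then have "0 < m"
    using track_number_ordered_graph_0[of ?E] by (cases m) auto
  have "card {u. (u, v) \<in> ?E} \<le> k" if "v < m" for v
    using that m(1) card_extremal_arcs[of v "Suc k"] by linarith
  then have "tree_width (ordered_graph ?E m) \<le> k"
    using \<open>0 < m\<close> by (intro tree_width_perfect_elimination[OF E extremal_arcs_simplicial])
  moreover have "real (\<Sum>{..Suc k}) = 1 / 2 * (real k + 1) * (real k + 2)"
    by (induction k) (auto simp: field_simps)
  ultimately show ?thesis
    using m(2) pair_graph_ordered_graph[OF E] by metis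
qed

end
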